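(* In $L(\mathfrak{sl}_2)^+$ define, for $i\geq 0$, $A^{\downarrow\uparrow}_i=-x\otimes(-t)^i$, $B^{\downarrow\uparrow}_i=(y\otimes t+z\otimes(t-1))(-t)^i$, $\psi^{\downarrow\uparrow}_i=-y\otimes(-t)^i$. Then: (i) The elements $\{A^{\downarrow\uparrow}_i\}_{i\in\mathbb{N}}$ form a basis for $X^\sigma_{21}\cap O$. (ii) The elements $\{B^{\downarrow\uparrow}_i\}_{i\in\mathbb{N}}$ form a basis for $X^\sigma_{03}\cap O$. (iii) The elements $\{\psi^{\downarrow\uparrow}_{i+1}\}_{i\in\mathbb{N}}$ form a basis for $X^\sigma_{32}\cap O$.
   Context: $\mathbb{F}$ is a field of characteristic zero; $\mathbb{N}=\{0,1,2,\ldots\}$; $\mathbb{I}=\{0,1,2,3\}$; tensor products are over $\mathbb{F}$. The tetrahedron algebra $\boxtimes$ is the Lie algebra over $\mathbb{F}$ with generators $\{x_{ij}\mid i,j\in\mathbb{I},\ i\neq j\}$ and relations: $x_{ij}+x_{ji}=0$ for distinct $i,j$; $[x_{ij},x_{jk}]=2x_{ij}+2x_{jk}$ for mutually distinct $i,j,k$; $[x_{ij},[x_{ij},[x_{ij},x_{kh}]]]=4[x_{ij},x_{kh}]$ for mutually distinct $h,i,j,k$. For distinct $i,j\in\mathbb{I}$, $X_{ij}$ is the subspace of all $\xi\in\boxtimes$ ($x_{ij}$-like elements) with $[x_{ij},\xi]=0$ and $[x_{kh},[x_{kh},[x_{kh},\xi]]]=4[x_{kh},\xi]$, where $\{h,i,j,k\}=\mathbb{I}$;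 $X_{ij}=X_{ji}$. $\mathfrak{sl}_2$ has basis $e,f,h$ with $[h,e]=2e$, $[h,f]=-2f$, $[e,f]=h$, and equitable basis $x=2e-h$, $y=-2f-h$, $z=h$. $\mathcal{A}=\mathbb{F}[t,t^{-1},(t-1)^{-1}]$, $t$ an indeterminate, $t'=1-t^{-1}$, $t''=(1-t)^{-1}$. $L(\mathfrak{sl}_2)^+=\mathfrak{sl}_2\otimes\mathcal{A}$ with $[u\otimes a,v\otimes b]=[u,v]\otimes ab$; it is a right $\mathcal{A}$-module via $(u\otimes a)b=u\otimes ab$. $\sigma:\boxtimes\to L(\mathfrak{sl}_2)^+$ is the (unique) Lie algebra isomorphism with $x_{12}\mapsto x\otimes1$, $x_{23}\mapsto y\otimes1$, $x_{31}\mapsto z\otimes1$, $x_{03}\mapsto y\otimes t+z\otimes(t-1)$, $x_{01}\mapsto z\otimes t'+x\otimes(t'-1)$, $x_{02}\mapsto x\otimes t''+y\otimes(t''-1)$. $X^\sigma_{ij}$ denotes the image of $X_{ij}$ under $\sigma$. The Onsager Lie algebra $O$ (generators $A,B$; relations $[A,[A,[A,B]]]=4[A,B]$, $[B,[B,[B,A]]]=4[B,A]$) is identified with the Lie subalgebra of $L(\mathfrak{sl}_2)^+$ generated by $A=x\otimes1$ and $B=y\otimes t+z\otimes(t-1)$. *)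

theory Defs
  imports
    Complex_Main
    "HOL-Library.Numeral_Type"
    "HOL-Computational_Algebra.Polynomial"
    "HOL-Computational_Algebra.Fraction_Field"
begin

section \<open>Bases and Lie algebras\<close>

text \<open>The family \<open>b\<close> is a basis of \<open>V\<close>. Injectivity is needed because \<^const>\<open>dependent\<close>
  speaks about the set of values of \<open>b\<close> and ignores repetitions.\<close>
definition (in vector_space) basis_family :: "('i \<Rightarrow> 'b) \<Rightarrow> 'b set \<Rightarrow> bool" where
  "basis_family b V \<longleftrightarrow> inj b \<and> \<not> dependent (range b) \<and> span (range b) = V"

locale lie_algebra = vector_space scale
  for scale :: "'a::field \<Rightarrow> 'v::ab_group_add \<Rightarrow> 'v" +
  fixes bracket :: "'v \<Rightarrow> 'v \<Rightarrow> 'v"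
  assumes bracket_add_left: "bracket (u + v) w = bracket u w + bracket v w"
    and bracket_add_right: "bracket u (v + w) = bracket u v + bracket u w"
    and bracket_scale_left: "bracket (scale c u) v = scale c (bracket u v)"
    and bracket_scale_right: "bracket u (scale c v) = scale c (bracket u v)"
    and bracket_self: "bracket u u = 0"
    and jacobi: "bracket u (bracket v w) + bracket v (bracket w u) + bracket w (bracket u v) = 0"
begin

definition lie_subalgebra :: "'v set \<Rightarrow> bool" where
  "lie_subalgebra W \<longleftrightarrow> subspace W \<and> (\<forall>u\<in>W. \<forall>v\<in>W. bracket u v \<in> W)"

definition generated :: "'v set \<Rightarrow> 'v set" where
  "generated S = lie_subalgebra hull S"

end

locale lie_algebra_iso =
  L1: lie_algebra s1 br1 + L2: lie_algebra s2 br2 + Vector_Spaces.linear s1 s2 \<phi>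
  for s1 :: "'a::field \<Rightarrow> 'v::ab_group_add \<Rightarrow> 'v" and br1
    and s2 :: "'a \<Rightarrow> 'w::ab_group_add \<Rightarrow> 'w" and br2 and \<phi> +
  assumes map_bracket: "\<phi> (br1 u v) = br2 (\<phi> u) (\<phi> v)"
    and bij: "bij \<phi>"


section \<open>The tetrahedron algebra\<close>

text \<open>
  The presentation is realised by nonassociative expressions in the generators, modulo the
  congruence generated by the Lie algebra axioms and the defining relations. The index set
  \<open>{0,1,2,3}\<close> is the type \<^typ>\<open>4\<close>. The expression \<open>Gen i i\<close> is not among the generators; it is
  removed by the rule \<open>gen_diag\<close>.
\<close>

datatype 'a tet_expr =
  Gen "4" "4"
  | Zero
  | Add "'a tet_expr" "'a tet_expr"
  | Scale 'a "'a tet_expr"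
  | Bracket "'a tet_expr" "'a tet_expr"

inductive tet_eq :: "'a::field tet_expr \<Rightarrow> 'a tet_expr \<Rightarrow> bool" (infix \<open>\<approx>\<close> 50) where
  refl: "u \<approx> u"
| sym: "u \<approx> v \<Longrightarrow> v \<approx> u"
| trans: "u \<approx> v \<Longrightarrow> v \<approx> w \<Longrightarrow> u \<approx> w"
| add_cong: "u \<approx> u' \<Longrightarrow> v \<approx> v' \<Longrightarrow> Add u v \<approx> Add u' v'"
| scale_cong: "u \<approx> u' \<Longrightarrow> Scale c u \<approx> Scale c u'"
| bracket_cong: "u \<approx> u' \<Longrightarrow> v \<approx> v' \<Longrightarrow> Bracket u v \<approx> Bracket u' v'"
| add_assoc: "Add (Add u v) w \<approx> Add u (Add v w)"
| add_comm: "Add u v \<approx> Add v u"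
| add_zero: "Add Zero u \<approx> u"
| add_inverse: "Add (Scale (- 1) u) u \<approx> Zero"
| scale_add: "Scale c (Add u v) \<approx> Add (Scale c u) (Scale c v)"
| add_scale: "Scale (c + d) u \<approx> Add (Scale c u) (Scale d u)"
| scale_scale: "Scale c (Scale d u) \<approx> Scale (c * d) u"
| scale_one: "Scale 1 u \<approx> u"
| bracket_add_left: "Bracket (Add u v) w \<approx> Add (Bracket u w) (Bracket v w)"
| bracket_add_right: "Bracket u (Add v w) \<approx> Add (Bracket u v) (Bracket u w)"
| bracket_scale_left: "Bracket (Scale c u) v \<approx> Scale c (Bracket u v)"
| bracket_scale_right: "Bracket u (Scale c v) \<approx> Scale c (Bracket u v)"
| bracket_self: "Bracket u u \<approx> Zero"
| jacobi: "Add (Add (Bracket u (Bracket v w)) (Bracket v (Bracket w u))) (Bracket w (Bracket u v)) \<approx> Zero"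
| gen_diag: "Gen i i \<approx> Zero"
| gen_skew: "i \<noteq> j \<Longrightarrow> Add (Gen i j) (Gen j i) \<approx> Zero"
| gen_triangle: "distinct [i, j, k] \<Longrightarrow>
    Bracket (Gen i j) (Gen j k) \<approx> Add (Scale 2 (Gen i j)) (Scale 2 (Gen j k))"
| gen_dolan_grady: "distinct [h, i, j, k] \<Longrightarrow>
    Bracket (Gen i j) (Bracket (Gen i j) (Bracket (Gen i j) (Gen k h)))
      \<approx> Scale 4 (Bracket (Gen i j) (Gen k h))"

quotient_type (overloaded) 'a tet = "'a::field tet_expr" / tet_eq
  by (rule equivpI)
    (auto simp: reflp_def symp_def transp_def intro: tet_eq.refl tet_eq.sym tet_eq.trans)

instantiation tet :: (field) ab_group_add
begin
lift_definition zero_tet :: "'a tet" is Zero .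
lift_definition plus_tet :: "'a tet \<Rightarrow> 'a tet \<Rightarrow> 'a tet" is Add by (rule tet_eq.add_cong)
lift_definition uminus_tet :: "'a tet \<Rightarrow> 'a tet" is "Scale (- 1)" by (rule tet_eq.scale_cong)
definition minus_tet :: "'a tet \<Rightarrow> 'a tet \<Rightarrow> 'a tet" where "minus_tet u v = u + - v"
instance
proof
  fix u v w :: "'a tet"
  show "u + v + w = u + (v + w)" by transfer (rule tet_eq.add_assoc)
  show "u + v = v + u" by transfer (rule tet_eq.add_comm)
  show "0 + u = u" by transfer (rule tet_eq.add_zero)
  show "- u + u = 0" by transfer (rule tet_eq.add_inverse)
  show "u - v = u + - v" by (rule minus_tet_def)
qed
end

lift_definition tet_scale :: "'a::field \<Rightarrow> 'a tet \<Rightarrow> 'a tet" is Scale by (rule tet_eq.scale_cong)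
lift_definition tet_bracket :: "'a::field tet \<Rightarrow> 'a tet \<Rightarrow> 'a tet" is Bracket
  by (rule tet_eq.bracket_cong)
lift_definition tet_gen :: "4 \<Rightarrow> 4 \<Rightarrow> 'a::field tet" is Gen .

global_interpretation tet: lie_algebra "tet_scale :: 'a::field \<Rightarrow> _" tet_bracket
  by unfold_locales (transfer, (rule tet_eq.scale_add tet_eq.add_scale tet_eq.scale_scale
      tet_eq.scale_one tet_eq.bracket_add_left tet_eq.bracket_add_right tet_eq.bracket_scale_left
      tet_eq.bracket_scale_right tet_eq.bracket_self tet_eq.jacobi))+

text \<open>The subspace \<open>X\<^sub>i\<^sub>j\<close> of \<open>x\<^sub>i\<^sub>j\<close>-like elements, for distinct \<open>i\<close>, \<open>j\<close>.\<close>
definition tet_X :: "4 \<Rightarrow> 4 \<Rightarrow> 'a::field tet set" where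
  "tet_X i j = {\<xi>. tet_bracket (tet_gen i j) \<xi> = 0 \<and>
     (\<forall>k h. {h, i, j, k} = UNIV \<longrightarrow>
        tet_bracket (tet_gen k h) (tet_bracket (tet_gen k h) (tet_bracket (tet_gen k h) \<xi>))
          = tet_scale 4 (tet_bracket (tet_gen k h) \<xi>))}"


section \<open>The ring of functions with poles at zero, one and infinity\<close>

text \<open>The subring \<open>F[t, 1/t, 1/(t - 1)]\<close> of the field \<open>F(t)\<close> of rational functions.\<close>

inductive_set three_point_set :: "'a::field poly fract set" where
  const: "Fract [:c:] 1 \<in> three_point_set"
| t: "Fract [:0, 1:] 1 \<in> three_point_set"
| t_inv: "inverse (Fract [:0, 1:] 1) \<in> three_point_set"
| tm1_inv: "inverse (Fract [:0, 1:] 1 - 1) \<in> three_point_set"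
| add: "p \<in> three_point_set \<Longrightarrow> q \<in> three_point_set \<Longrightarrow> p + q \<in> three_point_set"
| mult: "p \<in> three_point_set \<Longrightarrow> q \<in> three_point_set \<Longrightarrow> p * q \<in> three_point_set"

typedef (overloaded) 'a three_point = "three_point_set :: 'a::field poly fract set"
  using three_point_set.t by blast

setup_lifting type_definition_three_point

lemma three_point_zero: "0 \<in> three_point_set"
  using three_point_set.const[of 0] by (simp add: Zero_fract_def)

lemma three_point_one: "1 \<in> three_point_set"
  using three_point_set.const[of 1] by (simp add: One_fract_def one_pCons)

lemma three_point_uminus: "p \<in> three_point_set \<Longrightarrow> - p \<in> three_point_set"
proof -
  have "Fract [:- 1:] 1 = (- 1 :: 'a poly fract)"
    by (simp add: One_fract_def one_pCons)
  then show "p \<in> three_point_set \<Longrightarrow> - p \<in> three_point_set"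
    using three_point_set.mult[OF three_point_set.const[of "- 1"], of p] by simp
qed

instantiation three_point :: (field) idom
begin
lift_definition zero_three_point :: "'a three_point" is 0 by (rule three_point_zero)
lift_definition one_three_point :: "'a three_point" is 1 by (rule three_point_one)
lift_definition plus_three_point :: "'a three_point \<Rightarrow> 'a three_point \<Rightarrow> 'a three_point" is "(+)"
  by (rule three_point_set.add)
lift_definition times_three_point :: "'a three_point \<Rightarrow> 'a three_point \<Rightarrow> 'a three_point" is "(*)"
  by (rule three_point_set.mult)
lift_definition uminus_three_point :: "'a three_point \<Rightarrow> 'a three_point" is uminus
  by (rule three_point_uminus)
lift_definition minus_three_point :: "'a three_point \<Rightarrow> 'a three_point \<Rightarrow> 'a three_point" is "(-)"
  unfolding diff_conv_add_uminus by (intro three_point_set.add three_point_uminus)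
instance
  by standard (transfer; simp add: algebra_simps)+
end

lift_definition tp_const :: "'a::field \<Rightarrow> 'a three_point" is "\<lambda>c. Fract [:c:] 1"
  by (rule three_point_set.const)
lift_definition tp_t :: "'a::field three_point" is "Fract [:0, 1:] 1"
  by (rule three_point_set.t)
lift_definition tp_t_inv :: "'a::field three_point" is "inverse (Fract [:0, 1:] 1)"
  by (rule three_point_set.t_inv)
lift_definition tp_tm1_inv :: "'a::field three_point" is "inverse (Fract [:0, 1:] 1 - 1)"
  by (rule three_point_set.tm1_inv)

lemma tp_t_inverse: "tp_t * tp_t_inv = 1"
  by transfer (simp add: One_fract_def eq_fract)

lemma tp_tm1_inverse: "(tp_t - 1) * tp_tm1_inv = 1"
  by transfer (simp add: One_fract_def eq_fract one_pCons)

lemma tp_const_simps [simp]: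
  "tp_const 0 = 0" "tp_const 1 = 1" "tp_const (- c) = - tp_const c"
  "tp_const (c + d) = tp_const c + tp_const d" "tp_const (c * d) = tp_const c * tp_const d"
  by (transfer; simp add: Zero_fract_def One_fract_def one_pCons)+

lemma tp_const_diff [simp]: "tp_const (c - d) = tp_const c - tp_const d"
  using tp_const_simps(4)[of c "- d"] by (simp del: tp_const_simps(4))

lemma tp_const_of_nat [simp]: "tp_const (of_nat n) = of_nat n"
  by (induction n) simp_all

lemma tp_const_numeral [simp]: "tp_const (numeral n) = numeral n"
  using tp_const_of_nat[of "numeral n"] by (simp del: tp_const_of_nat)

text \<open>\<open>t' = 1 - 1/t\<close> and \<open>t'' = 1/(1 - t)\<close>.\<close>
definition tp_t' :: "'a::field three_point" where "tp_t' = 1 - tp_t_inv"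
definition tp_t'' :: "'a::field three_point" where "tp_t'' = - tp_tm1_inv"

lemma tp_t''_inverse: "(1 - tp_t) * tp_t'' = 1"
  using tp_tm1_inverse by (simp add: tp_t''_def algebra_simps)


section \<open>The Lie algebra sl2 and its three-point loop algebra\<close>

text \<open>
  \<open>SL2 p q r\<close> is the element \<open>p e + q f + r h\<close> of the Lie algebra sl2 over a commutative ring.
  The tensor product of sl2 over a field with a commutative algebra \<open>R\<close> over this field is sl2
  over \<open>R\<close>: this is the free \<open>R\<close>-module on \<open>e\<close>, \<open>f\<close>, \<open>h\<close>. The lemmas
  \<open>tensor_universal\<close> and \<open>tensor_bracket\<close> below confirm this for \<open>R = F[t, 1/t, 1/(t - 1)]\<close>.
\<close>

datatype 'r sl2 = SL2 (coeff_e: 'r) (coeff_f: 'r) (coeff_h: 'r)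

instantiation sl2 :: (ab_group_add) ab_group_add
begin
definition "0 = SL2 0 0 0"
definition "u + v = SL2 (coeff_e u + coeff_e v) (coeff_f u + coeff_f v) (coeff_h u + coeff_h v)"
definition "- u = SL2 (- coeff_e u) (- coeff_f u) (- coeff_h u)"
definition "u - v = SL2 (coeff_e u - coeff_e v) (coeff_f u - coeff_f v) (coeff_h u - coeff_h v)"
instance
  by standard
    (simp_all add: zero_sl2_def plus_sl2_def uminus_sl2_def minus_sl2_def algebra_simps)
end

lemma coeff_simps [simp]:
  "coeff_e 0 = 0" "coeff_f 0 = 0" "coeff_h 0 = 0"
  "coeff_e (u + v) = coeff_e u + coeff_e v" "coeff_f (u + v) = coeff_f u + coeff_f v"
  "coeff_h (u + v) = coeff_h u + coeff_h v"
  "coeff_e (- u) = - coeff_e u" "coeff_f (- u) = - coeff_f u" "coeff_h (- u) = - coeff_h u"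
  "coeff_e (u - v) = coeff_e u - coeff_e v" "coeff_f (u - v) = coeff_f u - coeff_f v"
  "coeff_h (u - v) = coeff_h u - coeff_h v"
  by (simp_all add: zero_sl2_def plus_sl2_def uminus_sl2_def minus_sl2_def)

definition sl2_act :: "'r::comm_ring_1 sl2 \<Rightarrow> 'r \<Rightarrow> 'r sl2" (infixl \<open>\<cdot>\<close> 70) where
  "u \<cdot> a = SL2 (coeff_e u * a) (coeff_f u * a) (coeff_h u * a)"

text \<open>The bilinear extension of \<open>[h,e] = 2e\<close>, \<open>[h,f] = -2f\<close>, \<open>[e,f] = h\<close>.\<close>
definition sl2_bracket :: "'r::comm_ring_1 sl2 \<Rightarrow> 'r sl2 \<Rightarrow> 'r sl2" where
  "sl2_bracket u v = SL2
     (2 * (coeff_h u * coeff_e v - coeff_e u * coeff_h v))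
     (2 * (coeff_f u * coeff_h v - coeff_h u * coeff_f v))
     (coeff_e u * coeff_f v - coeff_f u * coeff_e v)"

definition sl2_e :: "'r::comm_ring_1 sl2" where "sl2_e = SL2 1 0 0"
definition sl2_f :: "'r::comm_ring_1 sl2" where "sl2_f = SL2 0 1 0"
definition sl2_h :: "'r::comm_ring_1 sl2" where "sl2_h = SL2 0 0 1"

definition sl2_x :: "'r::comm_ring_1 sl2" where "sl2_x = sl2_e \<cdot> 2 - sl2_h"
definition sl2_y :: "'r::comm_ring_1 sl2" where "sl2_y = sl2_f \<cdot> (- 2) - sl2_h"
definition sl2_z :: "'r::comm_ring_1 sl2" where "sl2_z = sl2_h"

definition sl2_scale :: "'a::field \<Rightarrow> 'a sl2 \<Rightarrow> 'a sl2" where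
  "sl2_scale c u = u \<cdot> c"

definition loop_scale :: "'a::field \<Rightarrow> 'a three_point sl2 \<Rightarrow> 'a three_point sl2" where
  "loop_scale c w = w \<cdot> tp_const c"

definition tp_scale :: "'a::field \<Rightarrow> 'a three_point \<Rightarrow> 'a three_point" where
  "tp_scale c a = tp_const c * a"

definition tensor :: "'a::field sl2 \<Rightarrow> 'a three_point \<Rightarrow> 'a three_point sl2" (infixl \<open>\<otimes>\<close> 70) where
  "u \<otimes> a = map_sl2 (\<lambda>c. tp_const c * a) u"

global_interpretation sl2: lie_algebra "sl2_scale :: 'a::field \<Rightarrow> _" sl2_bracket
  by unfold_locales
    (auto intro!: sl2.expand simp: sl2_scale_def sl2_act_def sl2_bracket_def algebra_simps)

global_interpretation loop: lie_algebra "loop_scale :: 'a::field \<Rightarrow> _" sl2_bracket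
  by unfold_locales
    (auto intro!: sl2.expand simp: loop_scale_def sl2_act_def sl2_bracket_def algebra_simps)

global_interpretation tp: vector_space "tp_scale :: 'a::field \<Rightarrow> _"
  by unfold_locales (auto simp: tp_scale_def algebra_simps)

lemma coeff_tensor [simp]:
  "coeff_e (u \<otimes> a) = tp_const (coeff_e u) * a" "coeff_f (u \<otimes> a) = tp_const (coeff_f u) * a"
  "coeff_h (u \<otimes> a) = tp_const (coeff_h u) * a"
  by (simp_all add: tensor_def sl2.map_sel)

lemma tensor_bracket: "sl2_bracket (u \<otimes> a) (v \<otimes> b) = sl2_bracket u v \<otimes> (a * b)"
  by (auto intro!: sl2.expand simp: sl2_bracket_def algebra_simps)

lemma tensor_act: "(u \<otimes> a) \<cdot> b = u \<otimes> (a * b)"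
  by (auto intro!: sl2.expand simp: sl2_act_def algebra_simps)

lemma linear_tensor:
  "Vector_Spaces.linear sl2_scale loop_scale (\<lambda>u. u \<otimes> a)"
  "Vector_Spaces.linear tp_scale loop_scale (\<lambda>a. u \<otimes> a)"
  by (unfold_locales; auto intro!: sl2.expand
      simp: sl2_scale_def loop_scale_def tp_scale_def sl2_act_def algebra_simps)+

lemma tensor_universal:
  fixes s :: "'a::field \<Rightarrow> 'w::ab_group_add \<Rightarrow> 'w" and \<beta> :: "'a sl2 \<Rightarrow> 'a three_point \<Rightarrow> 'w"
  assumes "\<And>a. Vector_Spaces.linear sl2_scale s (\<lambda>u. \<beta> u a)"
    and "\<And>u. Vector_Spaces.linear tp_scale s (\<beta> u)"
  shows "\<exists>!g. Vector_Spaces.linear loop_scale s g \<and> (\<forall>u a. g (u \<otimes> a) = \<beta> u a)"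
proof -
  interpret \<beta>: Vector_Spaces.linear sl2_scale s "\<lambda>u. \<beta> u a" for a by (rule assms)
  interpret \<beta>': Vector_Spaces.linear tp_scale s "\<beta> u" for u by (rule assms)
  define g where "g w = \<beta> sl2_e (coeff_e w) + \<beta> sl2_f (coeff_f w) + \<beta> sl2_h (coeff_h w)" for w
  have decomp: "w = sl2_e \<otimes> coeff_e w + sl2_f \<otimes> coeff_f w + sl2_h \<otimes> coeff_h w"
    for w :: "'a three_point sl2"
    by (auto intro!: sl2.expand simp: sl2_e_def sl2_f_def sl2_h_def)
  have lin: "Vector_Spaces.linear loop_scale s g"
  proof unfold_locales
    show "g (v + w) = g v + g w" for v w
      by (simp add: g_def \<beta>'.add algebra_simps)
    show "g (loop_scale c w) = s c (g w)" for c w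
      using \<beta>'.scale[of _ c]
      by (simp add: g_def loop_scale_def sl2_act_def tp_scale_def mult.commute
          \<beta>.vs2.scale_right_distrib)
  qed
  have val: "g (u \<otimes> a) = \<beta> u a" for u a
  proof -
    have u: "u = sl2_scale (coeff_e u) sl2_e + sl2_scale (coeff_f u) sl2_f
        + sl2_scale (coeff_h u) sl2_h"
      by (auto intro!: sl2.expand simp: sl2_e_def sl2_f_def sl2_h_def sl2_scale_def sl2_act_def)
    have "\<beta> u a = s (coeff_e u) (\<beta> sl2_e a) + s (coeff_f u) (\<beta> sl2_f a)
        + s (coeff_h u) (\<beta> sl2_h a)"
      by (subst u) (simp only: \<beta>.add \<beta>.scale)
    also have "\<dots> = g (u \<otimes> a)"
      using \<beta>'.scale[of _ _ a] by (simp add: g_def tp_scale_def)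
    finally show ?thesis by simp
  qed
  show ?thesis
  proof (rule ex1I[of _ g])
    show "Vector_Spaces.linear loop_scale s g \<and> (\<forall>u a. g (u \<otimes> a) = \<beta> u a)"
      using lin val by blast
  next
    fix g' assume g': "Vector_Spaces.linear loop_scale s g' \<and> (\<forall>u a. g' (u \<otimes> a) = \<beta> u a)"
    then interpret g': Vector_Spaces.linear loop_scale s g' by blast
    show "g' = g"
    proof
      fix w
      show "g' w = g w"
        by (subst decomp[of w]) (simp add: g'.add g' g_def)
    qed
  qed
qed


section \<open>The Onsager Lie algebra and the three families\<close>

definition onsager_A :: "'a::field three_point sl2" where
  "onsager_A = sl2_x \<otimes> 1"

definition onsager_B :: "'a::field three_point sl2" where
  "onsager_B = sl2_y \<otimes> tp_t + sl2_z \<otimes> (tp_t - 1)"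

definition onsager :: "'a::field three_point sl2 set" where
  "onsager = loop.generated {onsager_A, onsager_B}"

definition A_du :: "nat \<Rightarrow> 'a::field three_point sl2" where
  "A_du i = - (sl2_x \<otimes> (- tp_t) ^ i)"

definition B_du :: "nat \<Rightarrow> 'a::field three_point sl2" where
  "B_du i = (sl2_y \<otimes> tp_t + sl2_z \<otimes> (tp_t - 1)) \<cdot> (- tp_t) ^ i"

definition psi_du :: "nat \<Rightarrow> 'a::field three_point sl2" where
  "psi_du i = - (sl2_y \<otimes> (- tp_t) ^ i)"

end

theory Submission
  imports Defs
begin

text \<open>
  On \<open>sl2\<close> over a commutative ring, \<open>(ad u)\<^sup>3 = 4 (r\<^sup>2 + p q) ad u\<close> for \<open>u = p e + q f + r h\<close>, and
  \<open>r\<^sup>2 + p q = 1\<close> for the images of \<open>x\<^sub>0\<^sub>1\<close>, \<open>x\<^sub>0\<^sub>3\<close>, \<open>x\<^sub>1\<^sub>2\<close>. The cubic conditions in the definition of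
  \<open>X\<^sub>i\<^sub>j\<close> are therefore automatic in the three cases at hand, and the image of \<open>X\<^sub>i\<^sub>j\<close> is the centraliser
  of the image of \<open>x\<^sub>i\<^sub>j\<close>, which is the free rank one module it generates. On the other hand the
  Onsager algebra is \<open>x F[t] + B F[t] + y t F[t]\<close>: this space is closed under the bracket, and
  bracketing with \<open>A\<close> and \<open>B\<close> produces it degree by degree. As \<open>x\<close>, \<open>B\<close>, \<open>y t\<close> are linearly
  independent, each intersection is a copy of \<open>F[t]\<close>, with basis the powers of \<open>-t\<close>.
\<close>

section \<open>Images of bases, and the powers of -t as a basis of F[t]\<close>

context Vector_Spaces.linear
begin

lemma basis_family_image:
  assumes "vs1.basis_family b V" "inj f"
  shows "vs2.basis_family (\<lambda>i. f (b i)) (f ` V)"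
proof -
  have "range (\<lambda>i. f (b i)) = f ` range b"
    by auto
  moreover have "inj (\<lambda>i. f (b i))"
    using assms by (auto simp: vs1.basis_family_def inj_on_def)
  ultimately show ?thesis
    using assms span_image[of "range b"] independent_injective_image[of "range b"]
    by (auto simp: vs1.basis_family_def vs2.basis_family_def intro: inj_on_subset)
qed

end

interpretation poly: vector_space "smult :: 'a::field \<Rightarrow> 'a poly \<Rightarrow> 'a poly"
  by unfold_locales (simp_all add: smult_add_left smult_add_right)

lemma linear_factor_power: "[:0, - 1 :: 'a::comm_ring_1:] ^ i = monom ((- 1) ^ i) i"
  by (induction i) (simp_all add: monom_0 one_pCons monom_Suc minus_monom)

text \<open>Up to sign the n-th power is the n-th monomial. Its coefficient at n vanishes for every
  other member of the family, which gives injectivity and independence; spanning is the expansion of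
  a polynomial into monomials.\<close>

lemma basis_family_powers:
  "poly.basis_family (\<lambda>i. [:0, - 1 :: 'a::field:] ^ i) UNIV"
proof -
  let ?b = "\<lambda>i. [:0, - 1 :: 'a:] ^ i"
  have coeff: "coeff (?b i) n = (if i = n then (- 1) ^ i else 0)" for i n
    by (simp add: linear_factor_power)
  have inj: "inj ?b"
  proof (rule injI)
    fix i j assume "?b i = ?b j"
    then have "coeff (?b i) i = coeff (?b j) i" by simp
    then show "i = j" by (simp add: coeff split: if_splits)
  qed
  have "\<not> poly.dependent (range ?b)"
  proof
    assume "poly.dependent (range ?b)"
    then obtain S c v where S: "finite S" "S \<subseteq> range ?b" "(\<Sum>v\<in>S. smult (c v) v) = 0"
      and v: "v \<in> S" "c v \<noteq> 0"
      unfolding poly.dependent_explicit by blast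
    from S v obtain n where n: "v = ?b n" by auto
    have *: "coeff w n = 0" if "w \<in> S - {v}" for w
      using that S(2) n by (auto simp: coeff)
    have "0 = coeff (\<Sum>v\<in>S. smult (c v) v) n"
      using S by simp
    also have "\<dots> = (\<Sum>w\<in>S. c w * coeff w n)"
      by (simp add: coeff_sum)
    also have "\<dots> = c v * coeff v n"
      using S(1) v(1) * by (simp add: sum.remove[of S v])
    finally show False
      using v n by (simp add: coeff)
  qed
  moreover have "p \<in> poly.span (range ?b)" for p
  proof -
    have "monom a n \<in> poly.span (range ?b)" for a n
    proof -
      \<comment> \<open>The extra \<open>(- 1) ^ n\<close> cancels the sign carried by the
        power.\<close>
      have "monom a n = smult (a * (- 1) ^ n) (?b n)"
        by (simp add: linear_factor_power smult_monom flip: power_mult_distrib)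
      then show ?thesis
        by (simp add: poly.span_base poly.span_scale)
    qed
    then show ?thesis
      by (subst poly_as_sum_of_monoms[of p, symmetric]) (auto intro: poly.span_sum)
  qed
  ultimately show ?thesis
    using inj by (auto simp: poly.basis_family_def)
qed

section \<open>The embedding of F[t] into the three-point ring\<close>

lemma Fract_poly_in_three_point_set: "Fract p 1 \<in> three_point_set"
proof (induction p)
  case 0
  show ?case by (rule three_point_set.const[of 0, simplified])
next
  case (pCons a p)
  have "Fract (pCons a p) 1 = Fract [:a:] 1 + Fract [:0, 1:] 1 * Fract p 1"
    by simp
  then show ?case
    using pCons by (metis three_point_set.intros(1,2,5,6))
qed

text \<open>Substitution of \<open>tp_t\<close> into a polynomial. It identifies F[t] with a subring
  of the three-point ring, so that each intersection becomes a free rank one module over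
  F[t].\<close>

definition tp_poly :: "'a::field poly \<Rightarrow> 'a three_point" where
  "tp_poly p = Abs_three_point (Fract p 1)"

lemma Rep_tp_poly: "Rep_three_point (tp_poly p) = Fract p 1"
  by (simp add: tp_poly_def Abs_three_point_inverse Fract_poly_in_three_point_set)

lemmas three_point_rep_eq = Rep_tp_poly zero_three_point.rep_eq one_three_point.rep_eq
  plus_three_point.rep_eq times_three_point.rep_eq uminus_three_point.rep_eq
  minus_three_point.rep_eq tp_const.rep_eq tp_t.rep_eq

lemma tp_poly_hom:
  "tp_poly 0 = 0" "tp_poly 1 = 1" "tp_poly (p + q) = tp_poly p + tp_poly q"
  "tp_poly (p * q) = tp_poly p * tp_poly q" "tp_poly (- p) = - tp_poly p"
  "tp_poly (p - q) = tp_poly p - tp_poly q"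
  by (simp_all add: three_point_rep_eq Zero_fract_def One_fract_def flip: Rep_three_point_inject)

lemma tp_poly_power: "tp_poly (p ^ n) = tp_poly p ^ n"
  by (induction n) (simp_all add: tp_poly_hom)

lemma tp_poly_numeral: "tp_poly (numeral n) = numeral n"
  by (induction n) (simp_all only: numeral.simps tp_poly_hom)

lemma tp_poly_t: "tp_poly [:0, 1:] = tp_t"
  by (simp add: three_point_rep_eq flip: Rep_three_point_inject)

lemma tp_poly_smult: "tp_poly (smult c p) = tp_const c * tp_poly p"
  by (simp add: three_point_rep_eq flip: Rep_three_point_inject)

lemma tp_poly_eq_iff: "tp_poly p = tp_poly q \<longleftrightarrow> p = q"
  by (simp add: three_point_rep_eq eq_fract flip: Rep_three_point_inject)

lemma tp_poly_minus_t: "tp_poly [:0, - 1:] = - tp_t"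
  using tp_poly_hom(5)[of "[:0, 1:]"] by (simp add: tp_poly_t)

lemma tp_t_neq [simp]: "tp_t \<noteq> (0 :: 'a::field three_point)" "tp_t \<noteq> (1 :: 'a three_point)"
proof -
  have "[:0, 1 :: 'a:] \<noteq> 0" "[:0, 1 :: 'a:] \<noteq> 1"
    by (simp_all add: one_pCons)
  then show "tp_t \<noteq> (0 :: 'a three_point)" "tp_t \<noteq> (1 :: 'a three_point)"
    by (metis tp_poly_eq_iff tp_poly_t tp_poly_hom(1,2))+
qed

section \<open>Coordinates, rank one modules and centralisers in the loop algebra\<close>

lemma coeff_act [simp]:
  "coeff_e (u \<cdot> a) = coeff_e u * a" "coeff_f (u \<cdot> a) = coeff_f u * a" "coeff_h (u \<cdot> a) = coeff_h u * a"
  by (simp_all add: sl2_act_def)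

lemma coeff_bracket [simp]:
  "coeff_e (sl2_bracket u v) = 2 * (coeff_h u * coeff_e v - coeff_e u * coeff_h v)"
  "coeff_f (sl2_bracket u v) = 2 * (coeff_f u * coeff_h v - coeff_h u * coeff_f v)"
  "coeff_h (sl2_bracket u v) = coeff_e u * coeff_f v - coeff_f u * coeff_e v"
  by (simp_all add: sl2_bracket_def)

lemma coeff_equitable [simp]:
  "coeff_e sl2_x = 2" "coeff_f sl2_x = 0" "coeff_h sl2_x = - 1"
  "coeff_e sl2_y = 0" "coeff_f sl2_y = - 2" "coeff_h sl2_y = - 1"
  "coeff_e sl2_z = 0" "coeff_f sl2_z = 0" "coeff_h sl2_z = 1"
  by (simp_all add: sl2_x_def sl2_y_def sl2_z_def sl2_e_def sl2_f_def sl2_h_def)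

lemma sl2_eq_iff:
  "u = v \<longleftrightarrow> coeff_e u = coeff_e v \<and> coeff_f u = coeff_f v \<and> coeff_h u = coeff_h v"
  by (auto intro: sl2.expand)

lemma coeff_loop_scale [simp]:
  "coeff_e (loop_scale c u) = coeff_e u * tp_const c"
  "coeff_f (loop_scale c u) = coeff_f u * tp_const c"
  "coeff_h (loop_scale c u) = coeff_h u * tp_const c"
  by (simp_all add: loop_scale_def)

text \<open>The three-point ring is a domain, so multiplying a nonzero \<open>u\<close> by
  polynomials is an injective linear map; it carries the basis of powers of -t to this
  family.\<close>

lemma basis_family_act:
  assumes "u \<noteq> 0"
  shows "loop.basis_family (\<lambda>i. u \<cdot> (- tp_t) ^ i) (range (\<lambda>p. u \<cdot> tp_poly p))"
proof -
  interpret Vector_Spaces.linear smult loop_scale "\<lambda>p. u \<cdot> tp_poly p"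
    by unfold_locales (auto simp: sl2_eq_iff tp_poly_hom tp_poly_smult algebra_simps)
  have "inj (\<lambda>p. u \<cdot> tp_poly p)"
    using assms by (auto simp: inj_def sl2_eq_iff tp_poly_eq_iff)
  from basis_family_image[OF basis_family_powers this] show ?thesis
    by (simp add: tp_poly_power tp_poly_minus_t)
qed

text \<open>In the hypothesis stands minus the determinant of \<open>u\<close> as a traceless 2 by 2
  matrix. When it is 1, \<open>u\<close> has eigenvalues 1 and -1 over a field, hence
  \<open>ad u\<close> has eigenvalues 2, 0, -2; the proof checks the resulting identity in
  coordinates over any commutative ring.\<close>

lemma sl2_ad_cubed:
  assumes "coeff_h u ^ 2 + coeff_e u * coeff_f u = 1"
  shows "sl2_bracket u (sl2_bracket u (sl2_bracket u v)) = sl2_bracket u v \<cdot> 4"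
proof -
  have "sl2_bracket u (sl2_bracket u (sl2_bracket u v))
      = sl2_bracket u v \<cdot> (4 * (coeff_h u ^ 2 + coeff_e u * coeff_f u))"
    by (simp add: sl2_eq_iff algebra_simps power2_eq_square)
  then show ?thesis
    using assms by simp
qed

text \<open>Characteristic zero allows cancelling the factors 2 that the bracket and the equitable
  basis introduce.\<close>

lemma two_neq_zero_three_point [simp]: "(2 :: 'a::field_char_0 three_point) \<noteq> 0"
  using tp_poly_eq_iff[of "2 :: 'a poly" 0] by (simp add: tp_poly_numeral tp_poly_hom)

text \<open>Since the coefficient of \<open>h\<close> in \<open>u\<close> is \<open>-1\<close>, a multiple of \<open>u\<close> is read off its coefficient of \<open>h\<close>.\<close>
lemma centralizer_eq:
  fixes u :: "'a::field_char_0 three_point sl2"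
  assumes "coeff_h u = - 1"
  shows "{w. sl2_bracket u w = 0} = range (\<lambda>a. u \<cdot> a)"
proof (intro set_eqI iffI)
  fix w assume "w \<in> {w. sl2_bracket u w = 0}"
  then have "2 * coeff_e w = 2 * - (coeff_e u * coeff_h w)"
    "2 * coeff_f w = 2 * - (coeff_f u * coeff_h w)"
    using assms by (auto simp: sl2_eq_iff algebra_simps eq_neg_iff_add_eq_0 neg_eq_iff_add_eq_0)
  then have "coeff_e w = - (coeff_e u * coeff_h w)" "coeff_f w = - (coeff_f u * coeff_h w)"
    by (simp_all only: mult_cancel_left two_neq_zero_three_point simp_thms)
  then have "w = u \<cdot> (- coeff_h w)"
    using assms by (auto simp: sl2_eq_iff)
  then show "w \<in> range (\<lambda>a. u \<cdot> a)" by (rule range_eqI)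
qed (auto simp: sl2_eq_iff algebra_simps)

section \<open>The Onsager algebra as a module over F[t]\<close>

lemma (in lie_algebra) lie_subalgebra_generated: "lie_subalgebra (generated S)"
  unfolding generated_def
  by (rule hull_in) (auto simp: lie_subalgebra_def subspace_def)

lemma coeff_onsager [simp]:
  "coeff_e onsager_A = 2" "coeff_f onsager_A = 0" "coeff_h onsager_A = - 1"
  "coeff_e onsager_B = 0" "coeff_f onsager_B = - 2 * tp_t" "coeff_h onsager_B = - 1"
  by (simp_all add: onsager_A_def onsager_B_def)

text \<open>Induction on the degree: bracketing \<open>?A k\<close> with B gives \<open>?Y k\<close>
  modulo \<open>?A k\<close> and \<open>?B k\<close>, and bracketing \<open>?Y k\<close> with A and
  with B gives \<open>?A (Suc k)\<close> and \<open>?B (Suc k)\<close> modulo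
  \<open>?Y k\<close>.\<close>

lemma onsager_powers_mem:
  fixes k :: nat
  shows "onsager_A \<cdot> (- tp_t) ^ k \<in> (onsager :: 'a::field_char_0 three_point sl2 set)" (is "?A k \<in> _")
    and "onsager_B \<cdot> (- tp_t) ^ k \<in> (onsager :: 'a three_point sl2 set)" (is "?B k \<in> _")
    and "(sl2_y \<otimes> tp_t) \<cdot> (- tp_t) ^ k \<in> (onsager :: 'a three_point sl2 set)" (is "?Y k \<in> _")
proof -
  let ?O = "onsager :: 'a three_point sl2 set"
  have "loop.lie_subalgebra ?O"
    unfolding onsager_def by (rule loop.lie_subalgebra_generated)
  then have sub: "loop.subspace ?O" and br: "\<And>u v. u \<in> ?O \<Longrightarrow> v \<in> ?O \<Longrightarrow> sl2_bracket u v \<in> ?O"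
    by (auto simp: loop.lie_subalgebra_def)
  have gens: "onsager_A \<in> ?O" "onsager_B \<in> ?O"
    using hull_subset[of "{onsager_A, onsager_B}" loop.lie_subalgebra]
    by (auto simp: onsager_def loop.generated_def)
  have cancel: "v \<in> ?O" if "loop_scale c v \<in> ?O" "c \<noteq> 0" for c v
    using loop.subspace_scale[OF sub that(1), of "inverse c"] that(2) by simp
  note closed = loop.subspace_add[OF sub] loop.subspace_diff[OF sub] loop.subspace_scale[OF sub]
  have Y: "?Y k \<in> ?O" if "?A k \<in> ?O" "?B k \<in> ?O" for k
  proof (rule cancel[of 4])
    \<comment> \<open>This is [A, B] = 2 A - 2 B + 4 y t, multiplied by (-t)^k.\<close>
    have "loop_scale 4 (?Y k) = sl2_bracket (?A k) onsager_B - loop_scale 2 (?A k) + loop_scale 2 (?B k)"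
      by (simp add: sl2_eq_iff algebra_simps)
    then show "loop_scale 4 (?Y k) \<in> ?O"
      by (simp add: closed that br gens)
  qed simp
  have AB: "?A k \<in> ?O \<and> ?B k \<in> ?O" for k
  proof (induction k)
    case 0
    have "?A 0 = onsager_A" "?B 0 = onsager_B"
      by (simp_all add: sl2_eq_iff)
    then show ?case
      using gens by simp
  next
    case (Suc k)
    then have k: "?Y k \<in> ?O"
      by (simp add: Y)
    \<comment> \<open>The relations are [A, y t] = 2 t A + 2 y t and [y t, B] = 2 t B - 2 y t. The
      scalar is -2 because raising the exponent multiplies by -t.\<close>
    have "loop_scale (- 2) (?A (Suc k)) = sl2_bracket onsager_A (?Y k) - loop_scale 2 (?Y k)"
      by (simp add: sl2_eq_iff algebra_simps)
    moreover have "loop_scale (- 2) (?B (Suc k)) = sl2_bracket (?Y k) onsager_B + loop_scale 2 (?Y k)"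
      by (simp add: sl2_eq_iff algebra_simps)
    ultimately have "loop_scale (- 2) (?A (Suc k)) \<in> ?O" "loop_scale (- 2) (?B (Suc k)) \<in> ?O"
      by (simp_all only: closed br gens k)
    then show ?case
      using cancel[of "- 2"] by auto
  qed
  show "?A k \<in> ?O" "?B k \<in> ?O" "?Y k \<in> ?O"
    using AB Y by blast+
qed

text \<open>The right-hand side is a subalgebra containing both generators, hence contains the hull.
  Conversely, each of its three summands is spanned by the elements of
  \<open>onsager_powers_mem\<close>.\<close>

lemma onsager_eq:
  "(onsager :: 'a::field_char_0 three_point sl2 set) =
    {onsager_A \<cdot> tp_poly p + onsager_B \<cdot> tp_poly q + (sl2_y \<otimes> tp_t) \<cdot> tp_poly r | p q r. True}"
  (is "?O = ?R")
proof
  let ?w = "\<lambda>p q r. onsager_A \<cdot> tp_poly p + onsager_B \<cdot> tp_poly q + (sl2_y \<otimes> tp_t) \<cdot> tp_poly r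
    :: 'a three_point sl2"
  have "loop.lie_subalgebra ?R"
    unfolding loop.lie_subalgebra_def
  proof (intro conjI ballI loop.subspaceI)
    have "0 = ?w 0 0 0"
      by (simp add: sl2_eq_iff tp_poly_hom)
    then show "0 \<in> ?R" by blast
  next
    fix u v assume "u \<in> ?R" "v \<in> ?R"
    then obtain p q r p' q' r' where uv: "u = ?w p q r" "v = ?w p' q' r'" by blast
    have "u + v = ?w (p + p') (q + q') (r + r')"
      by (simp add: uv sl2_eq_iff tp_poly_hom algebra_simps)
    then show "u + v \<in> ?R" by blast
    define t :: "'a poly" where "t = [:0, 1:]"
    then have t: "tp_poly t = tp_t" by (simp add: tp_poly_t)
    \<comment> \<open>Bilinear expansion over F[t] of the brackets among A, B and y t; their
      structure constants are polynomials in t, which is why the space is closed.\<close>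
    have "sl2_bracket u v =
        ?w (2 * (p * q' - q * p') + 2 * t * (p * r' - r * p'))
          (- 2 * (p * q' - q * p') + 2 * t * (r * q' - q * r'))
          (4 * (p * q' - q * p') + 2 * (p * r' - r * p') - 2 * (r * q' - q * r'))"
      by (simp add: uv sl2_eq_iff tp_poly_hom tp_poly_numeral t algebra_simps)
    then show "sl2_bracket u v \<in> ?R" by blast
  next
    fix c u assume "u \<in> ?R"
    then obtain p q r where u: "u = ?w p q r" by blast
    have "loop_scale c u = ?w (smult c p) (smult c q) (smult c r)"
      by (simp add: u sl2_eq_iff tp_poly_smult algebra_simps)
    then show "loop_scale c u \<in> ?R" by blast
  qed
  moreover have "onsager_A = ?w 1 0 0" "onsager_B = ?w 0 1 0"
    by (simp_all add: sl2_eq_iff tp_poly_hom)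
  then have "{onsager_A, onsager_B} \<subseteq> ?R" by blast
  ultimately show "?O \<subseteq> ?R"
    unfolding onsager_def loop.generated_def by (intro hull_minimal)
next
  have sub: "loop.subspace ?O"
    using loop.lie_subalgebra_generated[of "{onsager_A, onsager_B :: 'a three_point sl2}"]
    by (simp add: onsager_def loop.lie_subalgebra_def)
  have *: "u \<cdot> tp_poly p \<in> ?O" if "u \<noteq> 0" "\<And>k. u \<cdot> (- tp_t) ^ k \<in> ?O" for u p
  proof -
    have "range (\<lambda>p. u \<cdot> tp_poly p) = loop.span (range (\<lambda>k. u \<cdot> (- tp_t) ^ k))"
      using basis_family_act[OF that(1)] by (simp add: loop.basis_family_def)
    also have "\<dots> \<subseteq> ?O"
      using that(2) sub by (intro loop.span_minimal) auto
    finally show ?thesis by auto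
  qed
  have "onsager_A \<noteq> (0 :: 'a three_point sl2)" "onsager_B \<noteq> (0 :: 'a three_point sl2)"
    "sl2_y \<otimes> tp_t \<noteq> (0 :: 'a three_point sl2)"
    by (simp_all add: sl2_eq_iff)
  then show "?R \<subseteq> ?O"
    using onsager_powers_mem by (auto intro!: loop.subspace_add[OF sub] *)
qed

section \<open>Rank one modules intersected with the Onsager algebra\<close>

lemma onsager_A_inter:
  "range (\<lambda>a. onsager_A \<cdot> a) \<inter> onsager = range (\<lambda>p. onsager_A \<cdot> tp_poly p :: 'a::field_char_0 three_point sl2)"
proof (intro equalityI subsetI)
  fix w :: "'a three_point sl2"
  assume "w \<in> range (\<lambda>a. onsager_A \<cdot> a) \<inter> onsager"
  then obtain a p q r where w: "w = onsager_A \<cdot> a"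
    "w = onsager_A \<cdot> tp_poly p + onsager_B \<cdot> tp_poly q + (sl2_y \<otimes> tp_t) \<cdot> tp_poly r"
    unfolding onsager_eq by blast
  \<comment> \<open>Of A, B and y t only A has a nonzero coefficient of e, so comparing that
    coefficient suffices.\<close>
  then have "a = tp_poly p"
    by (simp add: sl2_eq_iff)
  with w(1) show "w \<in> range (\<lambda>p. onsager_A \<cdot> tp_poly p)" by blast
next
  fix w :: "'a three_point sl2"
  assume "w \<in> range (\<lambda>p. onsager_A \<cdot> tp_poly p)"
  then obtain p where "w = onsager_A \<cdot> tp_poly p + onsager_B \<cdot> tp_poly 0 + (sl2_y \<otimes> tp_t) \<cdot> tp_poly 0"
    by (auto simp: sl2_eq_iff tp_poly_hom)
  moreover from this have "w = onsager_A \<cdot> tp_poly p"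
    by (simp add: sl2_eq_iff tp_poly_hom)
  ultimately show "w \<in> range (\<lambda>a. onsager_A \<cdot> a) \<inter> onsager"
    unfolding onsager_eq by blast
qed

lemma onsager_B_inter:
  "range (\<lambda>a. onsager_B \<cdot> a) \<inter> onsager = range (\<lambda>p. onsager_B \<cdot> tp_poly p :: 'a::field_char_0 three_point sl2)"
proof (intro equalityI subsetI)
  fix w :: "'a three_point sl2"
  assume "w \<in> range (\<lambda>a. onsager_B \<cdot> a) \<inter> onsager"
  then obtain a p q r where w: "w = onsager_B \<cdot> a"
    "w = onsager_A \<cdot> tp_poly p + onsager_B \<cdot> tp_poly q + (sl2_y \<otimes> tp_t) \<cdot> tp_poly r"
    unfolding onsager_eq by blast
  then have p: "tp_poly p = 0"
    by (simp add: sl2_eq_iff)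
  have "2 * (tp_t * a) = 2 * (tp_t * (tp_poly q + tp_poly r))" "- a = - (tp_poly q + tp_t * tp_poly r)"
    using arg_cong[OF w(2), of coeff_f] arg_cong[OF w(2), of coeff_h]
    by (simp_all add: w(1) p algebra_simps)
  then have "a = tp_poly q + tp_poly r" "a = tp_poly q + tp_t * tp_poly r"
    by (simp_all only: mult_cancel_left neg_equal_iff_equal two_neq_zero_three_point tp_t_neq simp_thms)
  \<comment> \<open>Comparing the two expressions gives (t - 1) r = 0, hence r = 0 because t differs
    from 1.\<close>
  then have "a = tp_poly q"
    by auto
  with w(1) show "w \<in> range (\<lambda>p. onsager_B \<cdot> tp_poly p)" by blast
next
  fix w :: "'a three_point sl2"
  assume "w \<in> range (\<lambda>p. onsager_B \<cdot> tp_poly p)"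
  then obtain q where "w = onsager_A \<cdot> tp_poly 0 + onsager_B \<cdot> tp_poly q + (sl2_y \<otimes> tp_t) \<cdot> tp_poly 0"
    by (auto simp: sl2_eq_iff tp_poly_hom)
  moreover from this have "w = onsager_B \<cdot> tp_poly q"
    by (simp add: sl2_eq_iff tp_poly_hom)
  ultimately show "w \<in> range (\<lambda>a. onsager_B \<cdot> a) \<inter> onsager"
    unfolding onsager_eq by blast
qed

text \<open>The factor t on the right is forced: only the multiples of y by polynomials without
  constant term lie in the Onsager algebra. This is why the third family starts at index 1.\<close>

lemma onsager_y_inter:
  "range (\<lambda>a. (sl2_y \<otimes> 1) \<cdot> a) \<inter> onsager
    = range (\<lambda>p. (sl2_y \<otimes> tp_t) \<cdot> tp_poly p :: 'a::field_char_0 three_point sl2)"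
proof (intro equalityI subsetI)
  fix w :: "'a three_point sl2"
  assume "w \<in> range (\<lambda>a. (sl2_y \<otimes> 1) \<cdot> a) \<inter> onsager"
  then obtain a p q r where w: "w = (sl2_y \<otimes> 1) \<cdot> a"
    "w = onsager_A \<cdot> tp_poly p + onsager_B \<cdot> tp_poly q + (sl2_y \<otimes> tp_t) \<cdot> tp_poly r"
    unfolding onsager_eq by blast
  then have p: "tp_poly p = 0"
    by (simp add: sl2_eq_iff)
  have "2 * a = 2 * (tp_t * (tp_poly q + tp_poly r))" "- a = - (tp_poly q + tp_t * tp_poly r)"
    using arg_cong[OF w(2), of coeff_f] arg_cong[OF w(2), of coeff_h]
    by (simp_all add: w(1) p algebra_simps)
  then have a: "a = tp_t * (tp_poly q + tp_poly r)" "a = tp_poly q + tp_t * tp_poly r"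
    by (simp_all only: mult_cancel_left neg_equal_iff_equal two_neq_zero_three_point tp_t_neq simp_thms)
  \<comment> \<open>The coefficients of f and h give t q + t r = q + t r, so (t - 1) q = 0.\<close>
  then have "tp_poly q = 0"
    by (auto simp: distrib_left)
  with w p have "w = (sl2_y \<otimes> tp_t) \<cdot> tp_poly r"
    by (simp add: sl2_eq_iff)
  then show "w \<in> range (\<lambda>p. (sl2_y \<otimes> tp_t) \<cdot> tp_poly p)" by (rule range_eqI)
next
  fix w :: "'a three_point sl2"
  assume "w \<in> range (\<lambda>p. (sl2_y \<otimes> tp_t) \<cdot> tp_poly p)"
  then obtain r where "w = onsager_A \<cdot> tp_poly 0 + onsager_B \<cdot> tp_poly 0 + (sl2_y \<otimes> tp_t) \<cdot> tp_poly r"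
    by (auto simp: sl2_eq_iff tp_poly_hom)
  moreover from this have "w = (sl2_y \<otimes> 1) \<cdot> (tp_t * tp_poly r)"
    by (simp add: sl2_eq_iff tp_poly_hom)
  ultimately show "w \<in> range (\<lambda>a. (sl2_y \<otimes> 1) \<cdot> a) \<inter> onsager"
    unfolding onsager_eq by blast
qed

section \<open>Images of the spaces X_ij under \<sigma>\<close>

lemma tet_gen_swap: "i \<noteq> j \<Longrightarrow> tet_gen j i = - (tet_gen i j :: 'a::field tet)"
proof -
  assume "i \<noteq> j"
  then have "tet_gen i j + tet_gen j i = (0 :: 'a tet)"
    by transfer (rule tet_eq.gen_skew)
  then show ?thesis
    by (simp add: add_eq_0_iff)
qed

text \<open>Injectivity of \<sigma> lets both defining conditions be tested in the loop algebra,
  where \<open>sl2_ad_cubed\<close> settles the cubic one. Surjectivity then yields the whole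
  centraliser.\<close>

lemma image_tet_X:
  fixes \<sigma> :: "'a::field tet \<Rightarrow> 'a three_point sl2"
  assumes "lie_algebra_iso tet_scale tet_bracket loop_scale sl2_bracket \<sigma>"
    and kh: "\<And>k h. {h, i, j, k} = UNIV \<Longrightarrow>
      coeff_h (\<sigma> (tet_gen k h)) ^ 2 + coeff_e (\<sigma> (tet_gen k h)) * coeff_f (\<sigma> (tet_gen k h)) = 1"
  shows "\<sigma> ` tet_X i j = {w. sl2_bracket (\<sigma> (tet_gen i j)) w = 0}"
proof -
  interpret lie_algebra_iso tet_scale tet_bracket loop_scale sl2_bracket \<sigma> by fact
  have inj: "\<sigma> u = \<sigma> v \<longleftrightarrow> u = v" for u v
    using bij by (simp add: bij_def inj_eq)
  have X: "\<xi> \<in> tet_X i j \<longleftrightarrow> sl2_bracket (\<sigma> (tet_gen i j)) (\<sigma> \<xi>) = 0" for \<xi>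
  proof -
    have "tet_bracket (tet_gen k h) (tet_bracket (tet_gen k h) (tet_bracket (tet_gen k h) \<xi>))
        = tet_scale 4 (tet_bracket (tet_gen k h) \<xi>)" if "{h, i, j, k} = UNIV" for k h
      using sl2_ad_cubed[OF kh[OF that], of "\<sigma> \<xi>"]
      by (simp add: map_bracket scale loop_scale_def flip: inj)
    then show ?thesis
      by (simp add: tet_X_def zero map_bracket flip: inj)
  qed
  have "w = \<sigma> (inv \<sigma> w)" for w
    using bij by (simp add: bij_def surj_f_inv_f)
  then show ?thesis
    using X by (auto simp: image_iff) metis
qed

text \<open>The images of \<open>tet_gen 2 1\<close> and \<open>tet_gen 3 2\<close> have
  h-coefficient 1; negating them makes \<open>centralizer_eq\<close> applicable.\<close>

lemma centralizer_minus:
  "{w. sl2_bracket (- u) w = 0} = {w. sl2_bracket u w = (0 :: 'a::field three_point sl2)}"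
  using loop.bracket_scale_left[of "- 1" u] by simp

theorem lemma8p2:
  fixes \<sigma> :: "'a::field_char_0 tet \<Rightarrow> 'a three_point sl2"
  assumes "lie_algebra_iso tet_scale tet_bracket loop_scale sl2_bracket \<sigma>"
    and "\<sigma> (tet_gen 1 2) = sl2_x \<otimes> 1"
    and "\<sigma> (tet_gen 2 3) = sl2_y \<otimes> 1"
    and "\<sigma> (tet_gen 3 1) = sl2_z \<otimes> 1"
    and "\<sigma> (tet_gen 0 3) = sl2_y \<otimes> tp_t + sl2_z \<otimes> (tp_t - 1)"
    and "\<sigma> (tet_gen 0 1) = sl2_z \<otimes> tp_t' + sl2_x \<otimes> (tp_t' - 1)"
    and "\<sigma> (tet_gen 0 2) = sl2_x \<otimes> tp_t'' + sl2_y \<otimes> (tp_t'' - 1)"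
  shows "loop.basis_family A_du (\<sigma> ` tet_X 2 1 \<inter> onsager) \<and>
         loop.basis_family B_du (\<sigma> ` tet_X 0 3 \<inter> onsager) \<and>
         loop.basis_family (\<lambda>i. psi_du (i + 1)) (\<sigma> ` tet_X 3 2 \<inter> onsager)"
proof -
  note iso = assms(1) and gens = assms(2-7)
  interpret lie_algebra_iso tet_scale tet_bracket loop_scale sl2_bracket \<sigma> by (rule iso)
  have swap: "\<sigma> (tet_gen j i) = - \<sigma> (tet_gen i j)" if "i \<noteq> j" for i j
    using that by (simp add: tet_gen_swap[of i j] neg)
  \<comment> \<open>The covering condition fixes the complementary pair of indices but not its
    order, so each generator is met together with its negative.\<close>
  have cases4: "k = a \<and> h = b \<or> k = b \<and> h = a"
    if "{h, i, j, k} = UNIV" "a \<noteq> b" "a \<notin> {i, j}" "b \<notin> {i, j}" for i j k h a b :: 4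
    using that UNIV_I[of a] UNIV_I[of b] by (metis insert_iff empty_iff)
  have A: "\<sigma> (tet_gen 2 1) = - onsager_A"
    using swap[of 1 2] by (simp add: gens onsager_A_def)
  have B: "\<sigma> (tet_gen 0 3) = onsager_B"
    by (simp add: gens onsager_B_def)
  have Y: "\<sigma> (tet_gen 3 2) = - (sl2_y \<otimes> 1)"
    using swap[of 2 3] by (simp add: gens)
  have X21: "\<sigma> ` tet_X 2 1 = range (\<lambda>a. onsager_A \<cdot> a)"
  proof -
    have "\<sigma> ` tet_X 2 1 = {w. sl2_bracket (\<sigma> (tet_gen 2 1)) w = 0}"
    proof (rule image_tet_X[OF iso])
      fix k h :: 4 assume "{h, 2, 1, k} = UNIV"
      from cases4[OF this, of 0 3]
      show "coeff_h (\<sigma> (tet_gen k h)) ^ 2 + coeff_e (\<sigma> (tet_gen k h)) * coeff_f (\<sigma> (tet_gen k h)) = 1"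
        using B swap[of 0 3] by auto
    qed
    then show ?thesis
      by (simp add: A centralizer_minus centralizer_eq)
  qed
  have X03: "\<sigma> ` tet_X 0 3 = range (\<lambda>a. onsager_B \<cdot> a)"
  proof -
    have "\<sigma> ` tet_X 0 3 = {w. sl2_bracket (\<sigma> (tet_gen 0 3)) w = 0}"
    proof (rule image_tet_X[OF iso])
      fix k h :: 4 assume "{h, 0, 3, k} = UNIV"
      from cases4[OF this, of 1 2]
      show "coeff_h (\<sigma> (tet_gen k h)) ^ 2 + coeff_e (\<sigma> (tet_gen k h)) * coeff_f (\<sigma> (tet_gen k h)) = 1"
        using gens(1) A by auto
    qed
    then show ?thesis
      by (simp add: B centralizer_eq)
  qed
  have X32: "\<sigma> ` tet_X 3 2 = range (\<lambda>a. (sl2_y \<otimes> 1) \<cdot> a)"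
  proof -
    have "\<sigma> ` tet_X 3 2 = {w. sl2_bracket (\<sigma> (tet_gen 3 2)) w = 0}"
    proof (rule image_tet_X[OF iso])
      fix k h :: 4 assume "{h, 3, 2, k} = UNIV"
      from cases4[OF this, of 0 1]
      \<comment> \<open>For the order 0, 1 the coefficient of f is 0 and that of h is
        \<open>tp_t' - (tp_t' - 1)\<close>, that is 1; the reversed order changes only
        signs.\<close>
      show "coeff_h (\<sigma> (tet_gen k h)) ^ 2 + coeff_e (\<sigma> (tet_gen k h)) * coeff_f (\<sigma> (tet_gen k h)) = 1"
        using gens(5) swap[of 0 1] by auto
    qed
    then show ?thesis
      by (simp add: Y centralizer_minus centralizer_eq)
  qed
  have nonzero: "- onsager_A \<noteq> (0 :: 'a three_point sl2)" "onsager_B \<noteq> (0 :: 'a three_point sl2)"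
    "sl2_y \<otimes> tp_t \<noteq> (0 :: 'a three_point sl2)"
    by (simp_all add: sl2_eq_iff)
  \<comment> \<open>The sign in \<open>A_du\<close> does not change the module: replace p by
    -p.\<close>
  have "range (\<lambda>p. - onsager_A \<cdot> tp_poly p) = range (\<lambda>p. onsager_A \<cdot> tp_poly p :: 'a three_point sl2)"
  proof -
    have "- onsager_A \<cdot> tp_poly p = onsager_A \<cdot> tp_poly (- p)" for p :: "'a poly"
      by (simp add: sl2_eq_iff tp_poly_hom)
    then show ?thesis
      by (auto simp: image_iff) (metis minus_minus)
  qed
  \<comment> \<open>In the third family the shifted index absorbs the sign: -y (-t)^(i+1) = y t
    (-t)^i.\<close>
  moreover have "A_du = (\<lambda>i. - onsager_A \<cdot> (- tp_t) ^ i :: 'a three_point sl2)"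
    "B_du = (\<lambda>i. onsager_B \<cdot> (- tp_t) ^ i :: 'a three_point sl2)"
    "(\<lambda>i. psi_du (i + 1)) = (\<lambda>i. (sl2_y \<otimes> tp_t) \<cdot> (- tp_t) ^ i :: 'a three_point sl2)"
    by (auto simp: fun_eq_iff sl2_eq_iff A_du_def B_du_def psi_du_def)
  ultimately show ?thesis
    using nonzero[THEN basis_family_act]
    by (simp add: X21 X03 X32 onsager_A_inter onsager_B_inter onsager_y_inter)
qed

end
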